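(* There is a one-to-one correspondence between strict hom-Lie 2-algebras (that is, 2-term $HL_\infty$-algebras with $l_3=0$) and crossed modules of hom-Lie algebras.
   Context: All vector spaces are over a fixed ground field of characteristic zero (e.g. $\mathbb R$). **Hom-Lie algebra.** A triple $(\mathfrak g,[\cdot,\cdot]_{\mathfrak g},\phi_{\mathfrak g})$ of a vector space, a skew-symmetric bilinear bracket and a linear map $\phi_{\mathfrak g}:\mathfrak g\to\mathfrak g$ with $\phi_{\mathfrak g}[u,v]_{\mathfrak g}=[\phi_{\mathfrak g}(u),\phi_{\mathfrak g}(v)]_{\mathfrak g}$ and $[\phi_{\mathfrak g}(u),[v,w]_{\mathfrak g}]_{\mathfrak g}+[\phi_{\mathfrak g}(v),[w,u]_{\mathfrak g}]_{\mathfrak g}+[\phi_{\mathfrak g}(w),[u,v]_{\mathfrak g}]_{\mathfrak g}=0$. A morphism of hom-Lie algebras is a linear map preserving brackets and intertwining the maps $\phi$. **Representation.** A representation of $\mathfrak g$ on a vector space $V$ with respect to $A\in\mathfrak{gl}(V)$ is a linear map $\rho:\mathfrak g\to\mathfrak{gl}(V)$ with $\rho(\phi_{\mathfrak g}(u))\circ A=A\circ\rho(u)$ and $\rho([u,v]_{\mathfrak g})\circ A=\rho(\phi_{\mathfrak g}(u))\circ\rho(v)-\rho(\phi_{\mathfrak g}(v))\circ\rho(u)$. **Crossed module of hom-Lie algebras.** A quadruple $((\mathfrak h,[\cdot,\cdot]_{\mathfrak h},\phi_{\mathfrak h}),(\mathfrak g,[\cdot,\cdot]_{\mathfrak g},\phi_{\mathfrak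 g}),dt,\varphi)$ where $\mathfrak h,\mathfrak g$ are hom-Lie algebras, $dt:\mathfrak h\to\mathfrak g$ is a hom-Lie algebra morphism and $\varphi:\mathfrak g\to\mathfrak{gl}(\mathfrak h)$, $x\mapsto\varphi_x$, is a representation of $\mathfrak g$ on the vector space $\mathfrak h$ with respect to $\phi_{\mathfrak h}$, such that $dt(\varphi_x(m))=[x,dt(m)]_{\mathfrak g}$ and $\varphi_{dt(m)}(m')=[m,m']_{\mathfrak h}$ for all $x\in\mathfrak g$, $m,m'\in\mathfrak h$. **2-term $HL_\infty$-algebras.** A 2-term $HL_\infty$-algebra $(V_1\xrightarrow{d}V_0,l_2,l_3,\phi_0,\phi_1)$ consists of a linear map $d:V_1\to V_0$; bilinear maps $l_2:V_i\times V_j\to V_{i+j}$ ($i,j\in\{0,1\}$, $V_2=0$); linear maps $\phi_0:V_0\to V_0$, $\phi_1:V_1\to V_1$ with $\phi_0\circ d=d\circ\phi_1$; and a skew-symmetric trilinear map $l_3:V_0\times V_0\times V_0\to V_1$ with $l_3(\phi_0(x),\phi_0(y),\phi_0(z))=\phi_1(l_3(x,y,z))$, such that for all $w,x,y,z\in V_0$, $m,n\in V_1$: (a) $l_2(x,y)=-l_2(y,x)$; (b) $l_2(x,m)=-l_2(m,x)$; (c) $l_2(m,n)=0$; (d) $d\,l_2(x,m)=l_2(x,dm)$; (e) $l_2(dm,n)=l_2(m,dn)$; (f) $\phi_0(l_2(x,y))=l_2(\phi_0(x),\phi_0(y))$; (g) $\phi_1(l_2(x,m))=l_2(\phi_0(x),\phi_1(m))$;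 (h) $d\,l_3(x,y,z)=l_2(\phi_0(x),l_2(y,z))+l_2(\phi_0(y),l_2(z,x))+l_2(\phi_0(z),l_2(x,y))$; (i) $l_3(x,y,dm)=l_2(\phi_0(x),l_2(y,m))+l_2(\phi_0(y),l_2(m,x))+l_2(\phi_1(m),l_2(x,y))$; (j) an identity each of whose terms involves $l_3$ linearly, which is trivially satisfied when $l_3=0$. When $l_3=0$ the left-hand sides of (h) and (i) are $0$. **The correspondence meant.** A strict hom-Lie 2-algebra is sent to the crossed module with $\mathfrak g=V_0$, $[\cdot,\cdot]_{\mathfrak g}=l_2|_{V_0\times V_0}$, $\phi_{\mathfrak g}=\phi_0$, $\mathfrak h=V_1$, $[m,n]_{\mathfrak h}=l_2(dm,n)$, $\phi_{\mathfrak h}=\phi_1$, $dt=d$, $\varphi_xm=l_2(x,m)$. Conversely, a crossed module is sent to $V_0=\mathfrak g$, $V_1=\mathfrak h$, $\phi_0=\phi_{\mathfrak g}$, $\phi_1=\phi_{\mathfrak h}$, $d=dt$, $l_2(x,y)=[x,y]_{\mathfrak g}$, $l_2(x,m)=-l_2(m,x)=\varphi_xm$, $l_2(m,n)=0$, $l_3=0$. *)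

theory Defs
  imports Complex_Main
begin

text \<open>
  A vector space is a type of class \<open>ab_group_add\<close> with a scalar multiplication satisfying
  \<^const>\<open>vector_space\<close>.  The name \<open>linear\<close> alone refers to real scalars in
  \<^theory>\<open>Complex_Main\<close>, hence the qualified \<^const>\<open>Vector_Spaces.linear\<close> below.
\<close>

definition bilinear_map ::
  "('k::field \<Rightarrow> 'a::ab_group_add \<Rightarrow> 'a) \<Rightarrow> ('k \<Rightarrow> 'b::ab_group_add \<Rightarrow> 'b) \<Rightarrow>
   ('k \<Rightarrow> 'c::ab_group_add \<Rightarrow> 'c) \<Rightarrow> ('a \<Rightarrow> 'b \<Rightarrow> 'c) \<Rightarrow> bool" where
  "bilinear_map sa sb sc f \<longleftrightarrow>
     (\<forall>x. Vector_Spaces.linear sb sc (\<lambda>y. f x y)) \<and>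
     (\<forall>y. Vector_Spaces.linear sa sc (\<lambda>x. f x y))"

definition trilinear_map ::
  "('k::field \<Rightarrow> 'a::ab_group_add \<Rightarrow> 'a) \<Rightarrow> ('k \<Rightarrow> 'b::ab_group_add \<Rightarrow> 'b) \<Rightarrow>
   ('a \<Rightarrow> 'a \<Rightarrow> 'a \<Rightarrow> 'b) \<Rightarrow> bool" where
  "trilinear_map sa sb f \<longleftrightarrow>
     (\<forall>x y. Vector_Spaces.linear sa sb (\<lambda>z. f x y z)) \<and>
     (\<forall>x z. Vector_Spaces.linear sa sb (\<lambda>y. f x y z)) \<and>
     (\<forall>y z. Vector_Spaces.linear sa sb (\<lambda>x. f x y z))"


section \<open>Hom-Lie algebras and their representations\<close>

record ('k, 'g) hom_lie =
  scale :: "'k \<Rightarrow> 'g \<Rightarrow> 'g"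
  bracket :: "'g \<Rightarrow> 'g \<Rightarrow> 'g"
  twist :: "'g \<Rightarrow> 'g"

definition hom_lie_algebra ::
  "('k::field_char_0, 'g::ab_group_add) hom_lie \<Rightarrow> bool" where
  "hom_lie_algebra G \<longleftrightarrow>
     vector_space (scale G) \<and>
     bilinear_map (scale G) (scale G) (scale G) (bracket G) \<and>
     (\<forall>u v. bracket G u v = - bracket G v u) \<and>
     Vector_Spaces.linear (scale G) (scale G) (twist G) \<and>
     (\<forall>u v. twist G (bracket G u v) = bracket G (twist G u) (twist G v)) \<and>
     (\<forall>u v w. bracket G (twist G u) (bracket G v w)
            + bracket G (twist G v) (bracket G w u)
            + bracket G (twist G w) (bracket G u v) = 0)"

definition hom_lie_morphism ::
  "('k::field_char_0, 'h::ab_group_add) hom_lie \<Rightarrow> ('k, 'g::ab_group_add) hom_lie \<Rightarrow>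
   ('h \<Rightarrow> 'g) \<Rightarrow> bool" where
  "hom_lie_morphism H G f \<longleftrightarrow>
     Vector_Spaces.linear (scale H) (scale G) f \<and>
     (\<forall>m n. f (bracket H m n) = bracket G (f m) (f n)) \<and>
     (\<forall>m. f (twist H m) = twist G (f m))"

text \<open>
  Here \<open>gl(V)\<close> is the space of all linear endomorphisms of \<open>V\<close>, invertible or not, and \<open>s\<close> is the
  scalar multiplication of \<open>V\<close>.  A linear map into \<open>gl(V)\<close> is a function \<open>\<rho>\<close> with every \<open>\<rho> u\<close>
  linear and with \<open>\<rho> u v\<close> linear in \<open>u\<close>, that is, a bilinear map.
\<close>

definition hom_lie_representation ::
  "('k::field_char_0, 'g::ab_group_add) hom_lie \<Rightarrow> ('k \<Rightarrow> 'v::ab_group_add \<Rightarrow> 'v) \<Rightarrow>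
   ('v \<Rightarrow> 'v) \<Rightarrow> ('g \<Rightarrow> 'v \<Rightarrow> 'v) \<Rightarrow> bool" where
  "hom_lie_representation G s A \<rho> \<longleftrightarrow>
     vector_space s \<and>
     Vector_Spaces.linear s s A \<and>
     bilinear_map (scale G) s s \<rho> \<and>
     (\<forall>u. \<rho> (twist G u) \<circ> A = A \<circ> \<rho> u) \<and>
     (\<forall>u v. \<rho> (bracket G u v) \<circ> A =
        (\<lambda>x. (\<rho> (twist G u) \<circ> \<rho> v) x - (\<rho> (twist G v) \<circ> \<rho> u) x))"


section \<open>Crossed modules of hom-Lie algebras\<close>

record ('k, 'h, 'g) crossed_module_data =
  source :: "('k, 'h) hom_lie"
  target :: "('k, 'g) hom_lie"
  dt :: "'h \<Rightarrow> 'g"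
  act :: "'g \<Rightarrow> 'h \<Rightarrow> 'h"

definition crossed_module ::
  "('k::field_char_0, 'h::ab_group_add, 'g::ab_group_add) crossed_module_data \<Rightarrow> bool" where
  "crossed_module C \<longleftrightarrow>
     hom_lie_algebra (source C) \<and>
     hom_lie_algebra (target C) \<and>
     hom_lie_morphism (source C) (target C) (dt C) \<and>
     hom_lie_representation (target C) (scale (source C)) (twist (source C)) (act C) \<and>
     (\<forall>x m. dt C (act C x m) = bracket (target C) x (dt C m)) \<and>
     (\<forall>m m'. act C (dt C m) m' = bracket (source C) m m')"


section \<open>2-term HL-infinity algebras\<close>

text \<open>
  The components of \<open>l\<^sub>2\<close> are indexed by the degrees of their arguments.  The component \<open>l11\<close> takes
  values in \<open>V\<^sub>2 = 0\<close>; it is typed with values in \<open>V\<^sub>1\<close>, and \<open>V\<^sub>2\<close> is the zero subspace of \<open>V\<^sub>1\<close>.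
\<close>

record ('k, 'v1, 'v0) two_term =
  scale1 :: "'k \<Rightarrow> 'v1 \<Rightarrow> 'v1"
  scale0 :: "'k \<Rightarrow> 'v0 \<Rightarrow> 'v0"
  diff :: "'v1 \<Rightarrow> 'v0"
  l00 :: "'v0 \<Rightarrow> 'v0 \<Rightarrow> 'v0"
  l01 :: "'v0 \<Rightarrow> 'v1 \<Rightarrow> 'v1"
  l10 :: "'v1 \<Rightarrow> 'v0 \<Rightarrow> 'v1"
  l11 :: "'v1 \<Rightarrow> 'v1 \<Rightarrow> 'v1"
  l3 :: "'v0 \<Rightarrow> 'v0 \<Rightarrow> 'v0 \<Rightarrow> 'v1"
  phi0 :: "'v0 \<Rightarrow> 'v0"
  phi1 :: "'v1 \<Rightarrow> 'v1"

text \<open>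
  The last clause is the coherence law for \<open>l\<^sub>3\<close>: the Jacobiator identity of Baez and Crans for
  2-term L-infinity algebras, with \<open>\<phi>\<^sub>0\<close> inserted so that each term has twist degree two.  Under
  \<open>d\<close> it becomes an identity that follows from the formula for \<open>d l\<^sub>3\<close>.  Skew-symmetry of \<open>l\<^sub>3\<close> is
  stated for the two transpositions of neighbouring arguments, which generate all permutations.
\<close>

definition two_term_HL_infinity ::
  "('k::field_char_0, 'v1::ab_group_add, 'v0::ab_group_add) two_term \<Rightarrow> bool" where
  "two_term_HL_infinity V \<longleftrightarrow>
     vector_space (scale0 V) \<and>
     vector_space (scale1 V) \<and>
     Vector_Spaces.linear (scale1 V) (scale0 V) (diff V) \<and>
     bilinear_map (scale0 V) (scale0 V) (scale0 V) (l00 V) \<and>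
     bilinear_map (scale0 V) (scale1 V) (scale1 V) (l01 V) \<and>
     bilinear_map (scale1 V) (scale0 V) (scale1 V) (l10 V) \<and>
     bilinear_map (scale1 V) (scale1 V) (scale1 V) (l11 V) \<and>
     Vector_Spaces.linear (scale0 V) (scale0 V) (phi0 V) \<and>
     Vector_Spaces.linear (scale1 V) (scale1 V) (phi1 V) \<and>
     phi0 V \<circ> diff V = diff V \<circ> phi1 V \<and>
     trilinear_map (scale0 V) (scale1 V) (l3 V) \<and>
     (\<forall>x y z. l3 V x y z = - l3 V y x z) \<and>
     (\<forall>x y z. l3 V x y z = - l3 V x z y) \<and>
     (\<forall>x y z. l3 V (phi0 V x) (phi0 V y) (phi0 V z) = phi1 V (l3 V x y z)) \<and>
     (\<forall>x y. l00 V x y = - l00 V y x) \<and>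
     (\<forall>x m. l01 V x m = - l10 V m x) \<and>
     (\<forall>m n. l11 V m n = 0) \<and>
     (\<forall>x m. diff V (l01 V x m) = l00 V x (diff V m)) \<and>
     (\<forall>m n. l01 V (diff V m) n = l10 V m (diff V n)) \<and>
     (\<forall>x y. phi0 V (l00 V x y) = l00 V (phi0 V x) (phi0 V y)) \<and>
     (\<forall>x m. phi1 V (l01 V x m) = l01 V (phi0 V x) (phi1 V m)) \<and>
     (\<forall>x y z. diff V (l3 V x y z) =
          l00 V (phi0 V x) (l00 V y z)
        + l00 V (phi0 V y) (l00 V z x)
        + l00 V (phi0 V z) (l00 V x y)) \<and>
     (\<forall>x y m. l3 V x y (diff V m) =
          l01 V (phi0 V x) (l01 V y m)
        + l01 V (phi0 V y) (l10 V m x)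
        + l10 V (phi1 V m) (l00 V x y)) \<and>
     (\<forall>w x y z.
          l3 V (l00 V w x) (phi0 V y) (phi0 V z)
        + l10 V (l3 V w x z) (phi0 V (phi0 V y))
        + l3 V (phi0 V w) (l00 V x z) (phi0 V y)
        + l3 V (l00 V w z) (phi0 V x) (phi0 V y)
        = l10 V (l3 V w x y) (phi0 V (phi0 V z))
        + l3 V (l00 V w y) (phi0 V x) (phi0 V z)
        + l3 V (phi0 V w) (l00 V x y) (phi0 V z)
        + l01 V (phi0 V (phi0 V w)) (l3 V x y z)
        + l10 V (l3 V w y z) (phi0 V (phi0 V x))
        + l3 V (phi0 V w) (l00 V y z) (phi0 V x))"

definition strict_hom_lie_2_algebra ::
  "('k::field_char_0, 'v1::ab_group_add, 'v0::ab_group_add) two_term \<Rightarrow> bool" where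
  "strict_hom_lie_2_algebra V \<longleftrightarrow>
     two_term_HL_infinity V \<and> (\<forall>x y z. l3 V x y z = 0)"


section \<open>The correspondence\<close>

definition to_crossed_module ::
  "('k::field_char_0, 'v1::ab_group_add, 'v0::ab_group_add) two_term \<Rightarrow>
   ('k, 'v1, 'v0) crossed_module_data" where
  "to_crossed_module V =
     \<lparr> source = \<lparr> scale = scale1 V, bracket = (\<lambda>m n. l01 V (diff V m) n), twist = phi1 V \<rparr>,
       target = \<lparr> scale = scale0 V, bracket = l00 V, twist = phi0 V \<rparr>,
       dt = diff V,
       act = l01 V \<rparr>"

definition to_two_term ::
  "('k::field_char_0, 'h::ab_group_add, 'g::ab_group_add) crossed_module_data \<Rightarrow>
   ('k, 'h, 'g) two_term" where
  "to_two_term C =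
     \<lparr> scale1 = scale (source C),
       scale0 = scale (target C),
       diff = dt C,
       l00 = bracket (target C),
       l01 = act C,
       l10 = (\<lambda>m x. - act C x m),
       l11 = (\<lambda>m n. 0),
       l3 = (\<lambda>x y z. 0),
       phi0 = twist (target C),
       phi1 = twist (source C) \<rparr>"

end

theory Submission
  imports Defs
begin

text \<open>
  On \<open>V\<^sub>1\<close> put \<open>[m, n] = l\<^sub>2(dm, n)\<close>.  Its skew-symmetry is the identity
  \<open>l\<^sub>2(dm, n) = l\<^sub>2(m, dn)\<close>.  For \<open>l\<^sub>3 = 0\<close> the formula for \<open>d l\<^sub>3\<close> is the hom-Jacobi identity on
  \<open>V\<^sub>0\<close>, the formula for \<open>l\<^sub>3(x, y, dm)\<close> is the representation law for \<open>l\<^sub>2(x, m)\<close>, and putting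
  \<open>x = du\<close>, \<open>y = dv\<close> in the latter gives the hom-Jacobi identity on \<open>V\<^sub>1\<close>.
\<close>

text \<open>Taking \<open>g\<close> to be the differential makes the bracket
  \<open>l01 V (diff V m) n\<close> bilinear.\<close>

lemma bilinear_map_compose_left:
  assumes "bilinear_map sa sb sc f" and "Vector_Spaces.linear s sa g"
  shows "bilinear_map s sb sc (\<lambda>x y. f (g x) y)"
proof -
  have "Vector_Spaces.linear s sc (\<lambda>x. f (g x) y)" for y
    using Vector_Spaces.linear_compose[OF assms(2), of sc "\<lambda>x. f x y"] assms(1)
    by (simp add: bilinear_map_def comp_def)
  with assms(1) show ?thesis
    by (simp add: bilinear_map_def)
qed

lemma linear_compose_uminus:
  assumes "Vector_Spaces.linear s1 s2 g"
  shows "Vector_Spaces.linear s1 s2 (\<lambda>x. - g x)"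
proof (rule vector_space_pair.linear_compose_neg[OF _ assms])
  show "vector_space_pair s1 s2"
    using assms by (simp add: vector_space_pair_def Vector_Spaces.linear_def)
qed

text \<open>Supplies bilinearity of the component \<open>l10\<close> that \<open>to_two_term\<close>
  builds from the action.\<close>

lemma bilinear_map_uminus_flip:
  assumes "bilinear_map sa sb sc f"
  shows "bilinear_map sb sa sc (\<lambda>y x. - f x y)"
  using assms by (simp add: bilinear_map_def linear_compose_uminus)

lemma bilinear_map_zero:
  assumes "vector_space sa" "vector_space sb" "vector_space sc"
  shows "bilinear_map sa sb sc (\<lambda>x y. 0)"
  using assms
  by (simp add: bilinear_map_def vector_space_pair.linear_zero vector_space_pair_def)

lemma trilinear_map_zero:
  assumes "vector_space sa" "vector_space sb"
  shows "trilinear_map sa sb (\<lambda>x y z. 0)"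
  using assms
  by (simp add: trilinear_map_def vector_space_pair.linear_zero vector_space_pair_def)

lemma bilinear_map_minus_right:
  assumes "bilinear_map sa sb sc f"
  shows "f x (- y) = - f x y"
proof -
  have "Vector_Spaces.linear sb sc (f x)"
    using assms by (simp add: bilinear_map_def)
  then have "module_hom sb sc (f x)"
    by (simp add: module_hom_iff_linear)
  then show ?thesis
    by (rule module_hom.neg)
qed

lemma crossed_module_to_crossed_module:
  fixes V :: "('k::field_char_0, 'v1::ab_group_add, 'v0::ab_group_add) two_term"
  assumes "strict_hom_lie_2_algebra V"
  shows "crossed_module (to_crossed_module V)"
proof -
  have V: "two_term_HL_infinity V" and l3: "l3 V x y z = 0" for x y z
    using assms by (simp_all add: strict_hom_lie_2_algebra_def)
  have vs: "vector_space (scale0 V)" "vector_space (scale1 V)"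
    and lin: "Vector_Spaces.linear (scale1 V) (scale0 V) (diff V)"
      "Vector_Spaces.linear (scale0 V) (scale0 V) (phi0 V)"
      "Vector_Spaces.linear (scale1 V) (scale1 V) (phi1 V)"
    and b00: "bilinear_map (scale0 V) (scale0 V) (scale0 V) (l00 V)"
    and b01: "bilinear_map (scale0 V) (scale1 V) (scale1 V) (l01 V)"
    and comm: "phi0 V \<circ> diff V = diff V \<circ> phi1 V"
    and skew: "\<forall>x y. l00 V x y = - l00 V y x"
    and skew01: "\<forall>x m. l01 V x m = - l10 V m x"
    and d: "\<forall>x m. diff V (l01 V x m) = l00 V x (diff V m)"
    and peiffer: "\<forall>m n. l01 V (diff V m) n = l10 V m (diff V n)"
    and phi0: "\<forall>x y. phi0 V (l00 V x y) = l00 V (phi0 V x) (phi0 V y)"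
    and phi1: "\<forall>x m. phi1 V (l01 V x m) = l01 V (phi0 V x) (phi1 V m)"
    and jac0: "\<forall>x y z. diff V (l3 V x y z) =
          l00 V (phi0 V x) (l00 V y z) + l00 V (phi0 V y) (l00 V z x) + l00 V (phi0 V z) (l00 V x y)"
    and jac1: "\<forall>x y m. l3 V x y (diff V m) =
          l01 V (phi0 V x) (l01 V y m) + l01 V (phi0 V y) (l10 V m x) + l10 V (phi1 V m) (l00 V x y)"
    using V unfolding two_term_HL_infinity_def by - (elim conjE, assumption)+
  \<comment> \<open>For vanishing \<open>l3\<close> the left-hand side of \<open>jac0\<close> is
    \<open>diff V 0\<close>.\<close>
  have d0: "diff V 0 = 0"
    using lin(1) unfolding Vector_Spaces.linear_iff by (metis add_cancel_right_right)
  have comm': "phi0 V (diff V m) = diff V (phi1 V m)" for m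
    using comm by (metis comp_apply)
  have l10: "l10 V m x = - l01 V x m" for m x
    using skew01 by simp
  have skew_h: "l01 V (diff V m) n = - l01 V (diff V n) m" for m n
    using peiffer l10 by metis
  have jac: "l00 V (phi0 V x) (l00 V y z) + l00 V (phi0 V y) (l00 V z x)
      + l00 V (phi0 V z) (l00 V x y) = 0" for x y z
    using jac0 l3 d0 by metis
  \<comment> \<open>With the left-hand side of \<open>jac1\<close> zero, \<open>l10\<close> leaves a
    relation in \<open>l01\<close> alone, whose last term
    \<open>- l01 V (l00 V x y) (phi1 V m)\<close> moves across.\<close>
  have rep: "l01 V (l00 V x y) (phi1 V m) =
      l01 V (phi0 V x) (l01 V y m) - l01 V (phi0 V y) (l01 V x m)" for x y m
    using jac1[rule_format, of x y m]
    by (simp add: l3 l10 bilinear_map_minus_right[OF b01] algebra_simps)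
  have jac_h: "l01 V (diff V (phi1 V u)) (l01 V (diff V v) w)
      + l01 V (diff V (phi1 V v)) (l01 V (diff V w) u)
      + l01 V (diff V (phi1 V w)) (l01 V (diff V u) v) = 0" for u v w
  proof -
    \<comment> \<open>Skew-symmetry of the inner bracket makes \<open>w\<close> the element acted
      on, as in \<open>rep\<close>.\<close>
    have 1: "l01 V (diff V (phi1 V v)) (l01 V (diff V w) u) =
        - l01 V (diff V (phi1 V v)) (l01 V (diff V u) w)"
      by (metis skew_h bilinear_map_minus_right[OF b01])
    \<comment> \<open>Skew-symmetry of the outer bracket puts [u, v] first; \<open>d\<close> then
      turns its differential into the bracket of \<open>diff V u\<close> and
      \<open>diff V v\<close>, giving the left-hand side of \<open>rep\<close>.\<close>
    have 2: "l01 V (diff V (phi1 V w)) (l01 V (diff V u) v) =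
        - l01 V (l00 V (diff V u) (diff V v)) (phi1 V w)"
      by (metis skew_h d)
    show ?thesis
      using rep[of "diff V u" "diff V v" w] by (simp add: 1 2 comm')
  qed
  have "hom_lie_algebra (target (to_crossed_module V))"
    using vs lin b00 phi0 jac
    by (simp add: hom_lie_algebra_def to_crossed_module_def) (use skew in blast)
  \<comment> \<open>The twist preserves this bracket by \<open>phi1\<close> at
    \<open>x = diff V m\<close>, combined with \<open>comm'\<close>.\<close>
  moreover have "hom_lie_algebra (source (to_crossed_module V))"
    using vs lin bilinear_map_compose_left[OF b01 lin(1)] phi1 comm' jac_h
    by (simp add: hom_lie_algebra_def to_crossed_module_def) (use skew_h in blast)
  moreover have "hom_lie_representation (target (to_crossed_module V))
      (scale1 V) (phi1 V) (l01 V)"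
    using vs lin b01 phi1 rep
    by (auto simp: hom_lie_representation_def to_crossed_module_def fun_eq_iff)
  \<comment> \<open>By \<open>d\<close> at \<open>x = diff V m\<close>, the differential preserves
    brackets; the identity relating action and source bracket holds by definition of that
    bracket.\<close>
  ultimately show ?thesis
    using lin d comm'
    by (simp add: crossed_module_def hom_lie_morphism_def to_crossed_module_def)
qed

text \<open>Each term of the coherence law is a value of \<open>l3\<close> or, up to sign, the
  action on such a value, so the law becomes trivial for \<open>l3 = 0\<close>.\<close>

lemma strict_hom_lie_2_algebra_to_two_term:
  fixes C :: "('k::field_char_0, 'h::ab_group_add, 'g::ab_group_add) crossed_module_data"
  assumes "crossed_module C"
  shows "strict_hom_lie_2_algebra (to_two_term C)"
proof -
  have H: "hom_lie_algebra (source C)" and G: "hom_lie_algebra (target C)"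
    and M: "hom_lie_morphism (source C) (target C) (dt C)"
    and R: "hom_lie_representation (target C) (scale (source C)) (twist (source C)) (act C)"
    and dt: "\<And>x m. dt C (act C x m) = bracket (target C) x (dt C m)"
    and peiffer: "\<And>m n. act C (dt C m) n = bracket (source C) m n"
    using assms by (simp_all add: crossed_module_def)
  have vs: "vector_space (scale (target C))" "vector_space (scale (source C))"
    and lin: "Vector_Spaces.linear (scale (source C)) (scale (target C)) (dt C)"
      "Vector_Spaces.linear (scale (target C)) (scale (target C)) (twist (target C))"
      "Vector_Spaces.linear (scale (source C)) (scale (source C)) (twist (source C))"
    and b00: "bilinear_map (scale (target C)) (scale (target C)) (scale (target C))
        (bracket (target C))"
    and b01: "bilinear_map (scale (target C)) (scale (source C)) (scale (source C)) (act C)"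
    and comm: "\<forall>m. dt C (twist (source C) m) = twist (target C) (dt C m)"
    and skew: "\<forall>x y. bracket (target C) x y = - bracket (target C) y x"
    and skew_h: "\<forall>m n. bracket (source C) m n = - bracket (source C) n m"
    and phi0: "\<forall>x y. twist (target C) (bracket (target C) x y) =
        bracket (target C) (twist (target C) x) (twist (target C) y)"
    and jac0: "\<forall>u v w. bracket (target C) (twist (target C) u) (bracket (target C) v w)
        + bracket (target C) (twist (target C) v) (bracket (target C) w u)
        + bracket (target C) (twist (target C) w) (bracket (target C) u v) = 0"
    using H G M R
    unfolding hom_lie_algebra_def hom_lie_morphism_def hom_lie_representation_def
    by - (elim conjE, assumption)+
  have phi1: "twist (source C) (act C x m) = act C (twist (target C) x) (twist (source C) m)" for x m
    using R unfolding hom_lie_representation_def by (metis comp_apply)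
  have rep: "act C (bracket (target C) x y) (twist (source C) m) =
      act C (twist (target C) x) (act C y m) - act C (twist (target C) y) (act C x m)" for x y m
    using R unfolding hom_lie_representation_def fun_eq_iff comp_apply by blast
  \<comment> \<open>These values settle the left-hand side of the formula for \<open>d l3\<close>
    and the compatibility of \<open>l3\<close> with the twists.\<close>
  have zero: "dt C 0 = 0" "twist (source C) 0 = 0"
    using lin(1,3) unfolding Vector_Spaces.linear_iff by (metis add_cancel_right_right)+
  have act0: "act C x 0 = 0" for x
    using b01 unfolding bilinear_map_def Vector_Spaces.linear_iff
    by (metis add_cancel_right_right)
  \<comment> \<open>As \<open>l10\<close> is minus the flipped action, this is the axiom
    \<open>l2(dm, n) = l2(m, dn)\<close>.\<close>
  have peiffer': "act C (dt C m) n = - act C (dt C n) m" for m n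
    using peiffer skew_h by metis
  have "two_term_HL_infinity (to_two_term C)"
    unfolding two_term_HL_infinity_def to_two_term_def
    by (simp add: vs lin b00 b01 bilinear_map_uminus_flip[OF b01] bilinear_map_zero
        trilinear_map_zero zero act0 comm dt phi0 phi1 jac0 rep
        bilinear_map_minus_right[OF b01] fun_eq_iff)
      (use skew peiffer' in blast)
  then show ?thesis
    by (simp add: strict_hom_lie_2_algebra_def to_two_term_def)
qed

text \<open>Only \<open>l10\<close>, \<open>l11\<close> and \<open>l3\<close> are rebuilt rather
  than copied; the axioms fix \<open>l10\<close> by \<open>l01\<close>, and strictness and degree
  make the other two zero.\<close>

lemma to_two_term_to_crossed_module:
  assumes "strict_hom_lie_2_algebra V"
  shows "to_two_term (to_crossed_module V) = V"
proof -
  have "\<forall>x y z. l3 V x y z = 0" "\<forall>m n. l11 V m n = 0" "\<forall>x m. l01 V x m = - l10 V m x"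
    using assms unfolding strict_hom_lie_2_algebra_def two_term_HL_infinity_def
    by - (elim conjE, assumption)+
  then show ?thesis
    by (intro two_term.equality) (simp_all add: to_two_term_def to_crossed_module_def fun_eq_iff)
qed

text \<open>Only the source bracket is recomputed, as \<open>act C (dt C m) m'\<close>, which the
  last crossed module axiom identifies with the original.\<close>

lemma to_crossed_module_to_two_term:
  assumes "crossed_module C"
  shows "to_crossed_module (to_two_term C) = C"
  using assms
  by (simp add: crossed_module_def to_two_term_def to_crossed_module_def)

theorem theorem5p4:
  shows "bij_betw to_crossed_module
           {V :: ('k::field_char_0, 'v1::ab_group_add, 'v0::ab_group_add) two_term.
              strict_hom_lie_2_algebra V}
           {C :: ('k, 'v1, 'v0) crossed_module_data. crossed_module C} \<and>
         bij_betw to_two_term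
           {C :: ('k, 'v1, 'v0) crossed_module_data. crossed_module C}
           {V :: ('k, 'v1, 'v0) two_term. strict_hom_lie_2_algebra V} \<and>
         (\<forall>V :: ('k, 'v1, 'v0) two_term. strict_hom_lie_2_algebra V \<longrightarrow>
            to_two_term (to_crossed_module V) = V) \<and>
         (\<forall>C :: ('k, 'v1, 'v0) crossed_module_data. crossed_module C \<longrightarrow>
            to_crossed_module (to_two_term C) = C)"
proof (intro conjI)
  show "bij_betw to_crossed_module
      {V :: ('k, 'v1, 'v0) two_term. strict_hom_lie_2_algebra V} {C. crossed_module C}"
    by (rule bij_betw_byWitness[where f' = to_two_term])
      (auto simp: to_two_term_to_crossed_module to_crossed_module_to_two_term
        crossed_module_to_crossed_module strict_hom_lie_2_algebra_to_two_term)
  show "bij_betw to_two_term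
      {C :: ('k, 'v1, 'v0) crossed_module_data. crossed_module C} {V. strict_hom_lie_2_algebra V}"
    by (rule bij_betw_byWitness[where f' = to_crossed_module])
      (auto simp: to_two_term_to_crossed_module to_crossed_module_to_two_term
        crossed_module_to_crossed_module strict_hom_lie_2_algebra_to_two_term)
qed (simp_all add: to_two_term_to_crossed_module to_crossed_module_to_two_term)

end
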